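(* Let $d\ge 1$ and let $\mathcal{U}$ be an update family on $\mathbb{Z}^d$ that is not supercritical unrooted. Then there exists a constant $\kappa>0$ such that for every $n\in\mathbb{N}$, writing $L_n=\lfloor \kappa n 2^n\rfloor$ and $\Lambda_n=\{-L_n,\dots,L_n\}^d$, every configuration $\eta\in V(n,\Lambda_n)$ satisfies $\eta_0=1$.
   Context: Fix $d\in\mathbb{N}^*$. An update family is a set $\mathcal{U}=\{X_1,\dots,X_m\}$, $m\ge1$, where each $X_i$ is a finite nonempty subset of $\mathbb{Z}^d\setminus\{0\}$. For $\Lambda\subset\mathbb{Z}^d$, configurations are elements of $\{0,1\}^\Lambda$; $1_\Lambda$ denotes the all-ones configuration. For $\eta\in\{0,1\}^\Lambda$ and $s\in\Lambda$, $\eta^s$ is $\eta$ with the state at $s$ flipped. A move from $\eta$ to $\eta'$ (both in $\{0,1\}^\Lambda$) is legal if $\eta'=\eta$, or if $\eta'=\eta^s$ for some $s\in\Lambda$ and there is $X\in\mathcal{U}$ such that every site of $s+X$ is in state $0$ in the configuration on $\mathbb{Z}^d$ equal to $\eta$ on $\Lambda$ and to $0$ outside $\Lambda$. A legal path from $\eta$ to $\eta'$ is a sequence $(\eta^j)_{0\le j\le m}$, $m\ge1$, with $\eta^0=\eta$, $\eta^m=\eta'$ and each move $\eta^j\to\eta^{j+1}$ legal; it is $n$-legal if every $\eta^j$ has at most $n$ zeroes in $\Lambda$. $V(n,\Lambda)$ is the set of $\eta\in\{0,1\}^\Lambda$ such that there is an $n$-legal path from $1_\Lambda$ to $\eta$.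 For $u\in S^{d-1}$ let $\mathbb{H}_u=\{x\in\mathbb{R}^d:\langle x,u\rangle<0\}$; $u$ is a stable direction of $\mathcal{U}$ if there is no $X\in\mathcal{U}$ with $X\subset\mathbb{H}_u$. $\mathcal{U}$ is supercritical unrooted if some hyperplane (linear subspace of dimension $d-1$) of $\mathbb{R}^d$ contains all stable directions of $\mathcal{U}$. *)

theory Defs
  imports "HOL-Analysis.Analysis"
begin

definition update_family :: "(int ^ 'd) set set \<Rightarrow> bool" where
  "update_family U \<longleftrightarrow> finite U \<and> U \<noteq> {} \<and>
     (\<forall>X\<in>U. finite X \<and> X \<noteq> {} \<and> 0 \<notin> X)"

definition rvec :: "int ^ 'd \<Rightarrow> real ^ 'd" where
  "rvec x = (\<chi> i. real_of_int (x $ i))"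

definition halfspace :: "real ^ 'd \<Rightarrow> (real ^ 'd) set" where
  "halfspace u = {x. inner x u < 0}"

definition stable_direction :: "(int ^ 'd) set set \<Rightarrow> real ^ 'd \<Rightarrow> bool" where
  "stable_direction U u \<longleftrightarrow> norm u = 1 \<and> \<not> (\<exists>X\<in>U. rvec ` X \<subseteq> halfspace u)"

definition supercritical_unrooted :: "(int ^ 'd) set set \<Rightarrow> bool" where
  "supercritical_unrooted U \<longleftrightarrow>
     (\<exists>H :: (real ^ 'd) set. subspace H \<and> dim H = CARD('d) - 1 \<and>
        {u. stable_direction U u} \<subseteq> H)"

text \<open>A configuration on \<Lambda> is represented by its extension by 0 outside \<Lambda>:
  a function with values in {0,1} on \<Lambda> and 0 outside \<Lambda>.\<close>
definition config :: "(int ^ 'd) set \<Rightarrow> (int ^ 'd \<Rightarrow> nat) set" where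
  "config \<Lambda> = {\<eta>. (\<forall>x\<in>\<Lambda>. \<eta> x \<in> {0, 1}) \<and> (\<forall>x. x \<notin> \<Lambda> \<longrightarrow> \<eta> x = 0)}"

definition ones :: "(int ^ 'd) set \<Rightarrow> int ^ 'd \<Rightarrow> nat" where
  "ones \<Lambda> = (\<lambda>x. if x \<in> \<Lambda> then 1 else 0)"

definition flip :: "(int ^ 'd \<Rightarrow> nat) \<Rightarrow> int ^ 'd \<Rightarrow> int ^ 'd \<Rightarrow> nat" where
  "flip \<eta> s = \<eta>(s := 1 - \<eta> s)"

definition legal_move ::
  "(int ^ 'd) set set \<Rightarrow> (int ^ 'd) set \<Rightarrow> (int ^ 'd \<Rightarrow> nat) \<Rightarrow> (int ^ 'd \<Rightarrow> nat) \<Rightarrow> bool" where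
  "legal_move U \<Lambda> \<eta> \<eta>' \<longleftrightarrow> \<eta>' = \<eta> \<or>
     (\<exists>s\<in>\<Lambda>. \<eta>' = flip \<eta> s \<and> (\<exists>X\<in>U. \<forall>y\<in>X. \<eta> (s + y) = 0))"

definition num_zeros :: "(int ^ 'd) set \<Rightarrow> (int ^ 'd \<Rightarrow> nat) \<Rightarrow> nat" where
  "num_zeros \<Lambda> \<eta> = card {x\<in>\<Lambda>. \<eta> x = 0}"

definition n_legal_path ::
  "(int ^ 'd) set set \<Rightarrow> nat \<Rightarrow> (int ^ 'd) set \<Rightarrow> (int ^ 'd \<Rightarrow> nat) list \<Rightarrow>
   (int ^ 'd \<Rightarrow> nat) \<Rightarrow> (int ^ 'd \<Rightarrow> nat) \<Rightarrow> bool" where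
  "n_legal_path U n \<Lambda> p \<eta> \<eta>' \<longleftrightarrow> length p \<ge> 2 \<and> hd p = \<eta> \<and> last p = \<eta>' \<and>
     (\<forall>\<xi>\<in>set p. \<xi> \<in> config \<Lambda> \<and> num_zeros \<Lambda> \<xi> \<le> n) \<and>
     (\<forall>j. Suc j < length p \<longrightarrow> legal_move U \<Lambda> (p ! j) (p ! Suc j))"

definition V :: "(int ^ 'd) set set \<Rightarrow> nat \<Rightarrow> (int ^ 'd) set \<Rightarrow> (int ^ 'd \<Rightarrow> nat) set" where
  "V U n \<Lambda> = {\<eta> \<in> config \<Lambda>. \<exists>p. n_legal_path U n \<Lambda> p (ones \<Lambda>) \<eta>}"

definition box :: "int \<Rightarrow> (int ^ 'd) set" where
  "box L = {x. \<forall>i. - L \<le> x $ i \<and> x $ i \<le> L}"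

end

theory Submission
  imports Defs
begin

text \<open>
  The stable directions span the whole space, so finitely many of them, \<open>v \<in> B\<close>, give
  coordinates \<open>f v x = \<langle>x, v\<rangle>\<close>. Stability and reversibility of the moves imply that the maximum of
  each \<open>f v\<close> over a cluster of zeros that does not interact with the other zeros is constant in time.
  One shows by induction on \<open>n\<close> that with at most \<open>n\<close> zeros a site \<open>s\<close> can only be reached if the box
  \<open>- m n \<le> f v z - f v s \<le> p n\<close> meets the complement of the domain, where
  \<open>p (n + 1) = 2 p n + 2 R\<close> and \<open>m (n + 1) = 2 m n + p n + 2 R\<close>, \<open>R\<close> bounding the range of the update
  rules. Otherwise, by the induction hypothesis, at some time all \<open>n + 1\<close> zeros are in the box of size
  \<open>n\<close>. Run the path backwards from this time to the empty set. As long as the cluster issued from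
  these zeros is isolated, at most \<open>n\<close> zeros come from the boundary, so these do not get far inside.
  The maximum of \<open>f v\<close> over the cluster stays the same, so the cluster never goes up and always has a
  zero in the slab \<open>- m n \<le> f v z - f v s \<le> p n\<close>; hence there are at most \<open>n\<close> zeros outside this slab
  and they get at most \<open>p n\<close> below it. So the cluster stays isolated forever and never disappears.
  The absence of growth upwards makes \<open>p n\<close> of order \<open>2 ^ n\<close>, and then \<open>m n\<close> is of order \<open>n 2 ^ n\<close>.
\<close>

section \<open>Zero sets and their moves in additive coordinates\<close>

locale stable_coords =
  fixes U :: "'a::ab_group_add set set" and B :: "'b set"
    and f :: "'b \<Rightarrow> 'a \<Rightarrow> real" and R :: real
  assumes f_add: "f v (x + y) = f v x + f v y"
    and zero_notin: "X \<in> U \<Longrightarrow> 0 \<notin> X"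
    and stable: "X \<in> U \<Longrightarrow> v \<in> B \<Longrightarrow> \<exists>x\<in>X. 0 \<le> f v x"
    and range_bound: "X \<in> U \<Longrightarrow> x \<in> X \<Longrightarrow> v \<in> B \<Longrightarrow> \<bar>f v x\<bar> \<le> R"
    and R_nonneg: "0 \<le> R"
    and B_nonempty: "B \<noteq> {}"
begin

text \<open>Configurations are represented by their sets of zeros inside the domain; flipping \<open>s\<close> is
  insertion or deletion, one of which is void.\<close>

definition move :: "nat \<Rightarrow> 'a set \<Rightarrow> 'a set \<Rightarrow> 'a set \<Rightarrow> bool" where
  "move n L Z Z' \<longleftrightarrow> finite Z \<and> finite Z' \<and> card Z \<le> n \<and> card Z' \<le> n \<and>
     (\<exists>s\<in>L. (Z' = insert s Z \<or> Z' = Z - {s}) \<and> (\<exists>X\<in>U. \<forall>x\<in>X. s + x \<in> Z \<or> s + x \<notin> L))"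

abbreviation reach :: "nat \<Rightarrow> 'a set \<Rightarrow> 'a set \<Rightarrow> 'a set \<Rightarrow> bool" where
  "reach n L \<equiv> (move n L)\<^sup>*\<^sup>*"

text \<open>Since \<open>0 \<notin> X\<close>, flipping \<open>s\<close> changes no state that the
  rule reads, so the same rule undoes the flip. This is what allows a path to be run
  backwards.\<close>

lemma move_sym: "move n L Z Z' \<Longrightarrow> move n L Z' Z"
proof -
  assume m: "move n L Z Z'"
  then obtain s X where s: "s \<in> L" "Z' = insert s Z \<or> Z' = Z - {s}"
    and X: "X \<in> U" "\<forall>x\<in>X. s + x \<in> Z \<or> s + x \<notin> L"
    unfolding move_def by blast
  have "\<forall>x\<in>X. s + x \<in> Z' \<or> s + x \<notin> L"
    using s X zero_notin[OF X(1)] by auto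
  moreover have "Z = insert s Z' \<or> Z = Z' - {s}"
    using s(2) by auto
  ultimately show ?thesis
    using m s(1) X(1) unfolding move_def by blast
qed

lemma reach_sym: "reach n L Z Z' \<Longrightarrow> reach n L Z' Z"
  by (induction rule: rtranclp_induct) (auto intro: move_sym converse_rtranclp_into_rtranclp)

lemma reach_finite: "reach n L {} Z \<Longrightarrow> finite Z \<and> card Z \<le> n"
  by (induction rule: rtranclp_induct) (auto simp: move_def)

text \<open>Sites outside the domain count as zeros, so a smaller domain only relaxes the
  constraint. A flip outside \<open>L'\<close> leaves no trace there, whence \<open>reach\<close>
  instead of \<open>move\<close> in the conclusion.\<close>

lemma move_restrict:
  assumes "move n L Z Z'" "L' \<subseteq> L" "card (Z \<inter> L') \<le> k" "card (Z' \<inter> L') \<le> k"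
  shows "reach k L' (Z \<inter> L') (Z' \<inter> L')"
proof -
  obtain s X where s: "s \<in> L" "Z' = insert s Z \<or> Z' = Z - {s}"
    and X: "X \<in> U" "\<forall>x\<in>X. s + x \<in> Z \<or> s + x \<notin> L"
    using assms(1) unfolding move_def by blast
  show ?thesis
  proof (cases "s \<in> L'")
    case True
    have "\<forall>x\<in>X. s + x \<in> Z \<inter> L' \<or> s + x \<notin> L'"
      using X(2) assms(2) by blast
    moreover have "Z' \<inter> L' = insert s (Z \<inter> L') \<or> Z' \<inter> L' = Z \<inter> L' - {s}"
      using s(2) True by auto
    ultimately have "move k L' (Z \<inter> L') (Z' \<inter> L')"
      using assms True X(1) unfolding move_def by auto
    then show ?thesis ..
  next
    case False
    then have "Z' \<inter> L' = Z \<inter> L'" using s(2) by auto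
    then show ?thesis by simp
  qed
qed

text \<open>Applied with \<open>k = n\<close> when \<open>n + 1\<close> zeros are allowed: either
  all of them are in \<open>L'\<close> at some time, or the induction hypothesis becomes available
  in the domain \<open>L'\<close>.\<close>

lemma reach_restrict_or_full:
  assumes "reach n L {} Z" "L' \<subseteq> L"
  shows "(\<exists>Y. reach n L {} Y \<and> k < card (Y \<inter> L')) \<or> reach k L' {} (Z \<inter> L')"
  using assms(1)
proof (induction rule: rtranclp_induct)
  case base
  then show ?case by simp
next
  case (step Y Z)
  show ?case
  proof (cases "\<exists>Y. reach n L {} Y \<and> k < card (Y \<inter> L')")
    case False
    then have *: "card (W \<inter> L') \<le> k" if "reach n L {} W" for W
      using that by (meson not_le)
    have "reach k L' (Y \<inter> L') (Z \<inter> L')"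
      using step move_restrict assms(2) * by (meson rtranclp.rtrancl_into_rtrancl)
    then show ?thesis
      using step.IH False by (meson rtranclp_trans)
  qed blast
qed

section \<open>Separation of a central cluster from the zeros near the boundary\<close>

text \<open>The extents below and above \<open>s\<close> are separate parameters because stability
  stops the upward spread of an isolated cluster but not its downward spread.\<close>

definition cbox :: "'a \<Rightarrow> real \<Rightarrow> real \<Rightarrow> 'a set" where
  "cbox s a b = {z. \<forall>v\<in>B. f v s - a \<le> f v z \<and> f v z \<le> f v s + b}"

text \<open>The boxes of sizes \<open>(m, p)\<close> and \<open>(m', p')\<close> are those of two consecutive induction steps.
  In the invariant, \<open>K\<close> is the cluster issued from \<open>Y\<close> and \<open>M\<close> the zeros coming from the boundary.\<close>

lemma isolated_cluster_persists:
  assumes IH: "\<And>L Z s. reach n L {} Z \<Longrightarrow> s \<in> Z \<Longrightarrow> \<not> cbox s m p \<subseteq> L"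
    and mp: "0 \<le> m" "0 \<le> p"
    and p': "2 * p + 2 * R \<le> p'" and m': "2 * m + p + 2 * R \<le> m'"
    and Y: "finite Y" "Y \<noteq> {}" "Y \<subseteq> cbox s m p"
    and W: "reach (Suc n) (cbox s m' p') Y W"
  shows "W \<noteq> {}"
proof -
  define L where "L = cbox s m' p'"
  \<comment> \<open>\<open>C\<close> will confine the cluster: no higher than the slabs
    \<open>F v\<close>, and at most \<open>p\<close> below them. \<open>Out\<close> consists of the
    sites too close to the boundary for \<open>IH\<close> to exclude them.\<close>
  define C where "C = cbox s (m + p) p"
  define Out where "Out = {z. \<exists>v\<in>B. f v z < f v s - m' + m \<or> f v s + p' - p < f v z}"
  define F where "F v = {z. f v s - m \<le> f v z \<and> f v z \<le> f v s + p}" for v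
  define c where "c v = Max (f v ` Y)" for v
  have c_bounds: "f v s - m \<le> c v" "c v \<le> f v s + p" if "v \<in> B" for v
  proof -
    have "c v \<in> f v ` Y" unfolding c_def using Y by (intro Max_in) auto
    then show "f v s - m \<le> c v" "c v \<le> f v s + p"
      using Y(3) that unfolding cbox_def by auto
  qed
  have compl_L: "z \<in> Out" if "z \<notin> L" for z
    using that mp unfolding L_def Out_def cbox_def by (auto simp: not_le) (smt (verit))+
  have small_box_L: "cbox z m p \<subseteq> L" if "z \<notin> Out" for z
  proof
    fix w assume w: "w \<in> cbox z m p"
    show "w \<in> L" unfolding L_def cbox_def
    proof (clarsimp)
      fix v assume "v \<in> B"
      then have "f v s - m' + m \<le> f v z" "f v z \<le> f v s + p' - p"
        "f v z - m \<le> f v w" "f v w \<le> f v z + p"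
        using that w unfolding Out_def cbox_def by force+
      then show "f v s - m' \<le> f v w \<and> f v w \<le> f v s + p'" by linarith
    qed
  qed
  \<comment> \<open>\<open>p'\<close> leaves a gap above \<open>C\<close> and \<open>m'\<close> one
    below, each wider than \<open>2 * R\<close>, which bounds the difference in any coordinate
    between two sites read by one rule.\<close>
  have sep: "\<exists>v\<in>B. 2 * R < \<bar>f v w - f v z\<bar>" if zw: "z \<in> C" "w \<in> Out" for z w
  proof -
    obtain v where v: "v \<in> B" "f v w < f v s - m' + m \<or> f v s + p' - p < f v w"
      using zw(2) unfolding Out_def by blast
    have "f v s - (m + p) \<le> f v z" "f v z \<le> f v s + p"
      using zw(1) v(1) unfolding C_def cbox_def by auto
    then have "2 * R < \<bar>f v w - f v z\<bar>" using v(2) p' m' by linarith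
    then show ?thesis using v(1) by blast
  qed

  \<comment> \<open>\<open>IH\<close> acts on the two \<open>reach\<close> clauses: the first keeps
    \<open>M\<close> in \<open>Out\<close>, the second limits how far \<open>K\<close>
    descends.\<close>
  define inv where "inv W \<longleftrightarrow> (\<exists>K M. W = K \<union> M \<and> K \<subseteq> C \<and> M \<subseteq> Out \<and>
      (\<forall>v\<in>B. (\<forall>z\<in>K. f v z \<le> c v) \<and> (\<exists>z\<in>K. f v z = c v)) \<and>
      reach n L {} M \<and> (\<forall>v\<in>B. reach n (L - F v) {} (W \<inter> (L - F v))))" for W
  have inv_I: "inv W"
    if "W = K \<union> M" "K \<subseteq> C" "M \<subseteq> Out" "\<And>v z. v \<in> B \<Longrightarrow> z \<in> K \<Longrightarrow> f v z \<le> c v"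
      "\<And>v. v \<in> B \<Longrightarrow> \<exists>z\<in>K. f v z = c v" "reach n L {} M"
      "\<And>v. v \<in> B \<Longrightarrow> reach n (L - F v) {} (W \<inter> (L - F v))" for W K M
    unfolding inv_def by (rule exI[of _ K], rule exI[of _ M]) (intro conjI ballI that)
  have "inv W"
    using W unfolding L_def[symmetric]
  proof (induction rule: rtranclp_induct)
    case base
    have "f v z \<le> c v" if "z \<in> Y" for v z
      unfolding c_def using that Y(1) by simp
    moreover have "\<exists>z\<in>Y. f v z = c v" for v
    proof -
      have "c v \<in> f v ` Y" unfolding c_def using Y by (intro Max_in) auto
      then show ?thesis by auto
    qed
    moreover have "Y \<subseteq> C"
      using Y(3) mp unfolding C_def cbox_def by fastforce
    moreover have "Y \<inter> (L - F v) = {}" if "v \<in> B" for v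
      using Y(3) that unfolding F_def cbox_def by auto
    ultimately show ?case
      unfolding inv_def by (intro exI[of _ Y] exI[of _ "{}"]) auto
  next
    case (step W W')
    obtain K M where KM: "W = K \<union> M" "K \<subseteq> C" "M \<subseteq> Out"
      and K_le: "\<And>v z. v \<in> B \<Longrightarrow> z \<in> K \<Longrightarrow> f v z \<le> c v"
      and K_eq: "\<And>v. v \<in> B \<Longrightarrow> \<exists>z\<in>K. f v z = c v"
      and M: "reach n L {} M" and WF: "\<And>v. v \<in> B \<Longrightarrow> reach n (L - F v) {} (W \<inter> (L - F v))"
      using step.IH unfolding inv_def by blast
    obtain t X where t: "t \<in> L" "W' = insert t W \<or> W' = W - {t}"
      and X: "X \<in> U" "\<forall>x\<in>X. t + x \<in> W \<or> t + x \<notin> L"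
      using step.hyps(2) unfolding move_def by blast
    have fin: "finite W'" "card W' \<le> Suc n" "finite W"
      using step.hyps(2) unfolding move_def by auto
    \<comment> \<open>A zero at height \<open>c v\<close> lies in the slab \<open>F v\<close>, so at
      most \<open>n\<close> of the \<open>n + 1\<close> zeros are outside it, and the move restricts
      to the domain \<open>L - F v\<close> with only \<open>n\<close> zeros.\<close>
    have WF': "reach n (L - F v) {} (W' \<inter> (L - F v))"
      if v: "v \<in> B" and z: "z \<in> W'" "f v z = c v" for v z
    proof -
      have "z \<in> F v" unfolding F_def using z(2) c_bounds[OF v] by simp
      then have "W' \<inter> (L - F v) \<subseteq> W' - {z}" by blast
      then have "card (W' \<inter> (L - F v)) \<le> card (W' - {z})"
        using fin by (intro card_mono) auto
      also have "\<dots> \<le> n" using fin z(1) by (simp add: card_Diff_singleton)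
      finally have "card (W' \<inter> (L - F v)) \<le> n" .
      then have "reach n (L - F v) (W \<inter> (L - F v)) (W' \<inter> (L - F v))"
        using move_restrict[OF step.hyps(2), of "L - F v" n] reach_finite[OF WF[OF v]] by auto
      then show ?thesis using WF[OF v] by force
    qed
    have X_nonempty: "X \<noteq> {}" using stable X(1) B_nonempty by blast
    have pure: "(\<forall>x\<in>X. t + x \<in> K) \<or> (\<forall>x\<in>X. t + x \<in> M \<or> t + x \<notin> L)"
    proof (rule ccontr)
      assume "\<not> ?thesis"
      then obtain x x' where x: "x \<in> X" "t + x \<notin> K" "x' \<in> X" "t + x' \<in> L" "t + x' \<notin> M"
        by blast
      then have "t + x' \<in> C" "t + x \<in> Out" using X(2) KM compl_L by blast+
      then obtain v where "v \<in> B" "2 * R < \<bar>f v (t + x) - f v (t + x')\<bar>" using sep by blast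
      moreover have "\<bar>f v x\<bar> \<le> R" "\<bar>f v x'\<bar> \<le> R"
        using range_bound X(1) x \<open>v \<in> B\<close> by blast+
      ultimately show False by (simp add: f_add)
    qed
    then show ?case
    proof
      assume XK: "\<forall>x\<in>X. t + x \<in> K"
      have t_Out: "t \<notin> Out"
      proof
        assume tO: "t \<in> Out"
        obtain x where x: "x \<in> X" using X_nonempty by blast
        then obtain v where "v \<in> B" "2 * R < \<bar>f v t - f v (t + x)\<bar>"
          using sep tO XK KM(2) by blast
        then show False using range_bound[OF X(1) x, of v] R_nonneg by (simp add: f_add)
      qed
      \<comment> \<open>By stability the rule reads a zero of \<open>K\<close> at least as high as
        \<open>t\<close>, and different from \<open>t\<close>. Hence neither inserting nor deleting
        \<open>t\<close> changes a maximum over \<open>K\<close>.\<close>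
      have up: "\<exists>z\<in>K. z \<noteq> t \<and> f v t \<le> f v z" if v: "v \<in> B" for v
      proof -
        obtain x where x: "x \<in> X" "0 \<le> f v x" using stable[OF X(1) v] by blast
        then have "t + x \<noteq> t" using zero_notin X(1) by auto
        then show ?thesis using x XK by (auto simp: f_add intro!: bexI[of _ "t + x"])
      qed
      have t_le: "f v t \<le> c v" if "v \<in> B" for v
        using up[OF that] K_le[OF that] by force
      have K_eq': "\<exists>z\<in>K. z \<noteq> t \<and> f v z = c v" if v: "v \<in> B" for v
        using K_eq[OF v] up[OF v] K_le[OF v] by (metis order.antisym)
      from t(2) show ?thesis
      proof
        assume ins: "W' = insert t W"
        have WFt: "reach n (L - F v) {} (W' \<inter> (L - F v))" if "v \<in> B" for v
          using WF'[OF that] K_eq[OF that] ins KM(1) by blast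
        have "t \<in> C"
          unfolding C_def cbox_def
        proof (clarsimp, intro conjI)
          fix v assume v: "v \<in> B"
          show "f v t \<le> f v s + p" using t_le[OF v] c_bounds[OF v] by linarith
          \<comment> \<open>Outside the slab, \<open>t\<close> is reached with \<open>n\<close>
            zeros in the domain \<open>L - F v\<close>. By \<open>IH\<close> the small box around
            \<open>t\<close> leaves this domain, yet it stays in \<open>L\<close>; so it meets the
            slab, and \<open>t\<close> is at most \<open>p\<close> below it.\<close>
          show "f v s - (m + p) \<le> f v t"
          proof (cases "t \<in> F v")
            case True
            then show ?thesis using mp unfolding F_def by auto
          next
            case False
            then have "t \<in> W' \<inter> (L - F v)" using ins t(1) by blast
            then have "\<not> cbox t m p \<subseteq> L - F v" using IH WFt[OF v] by blast
            then obtain w where w: "w \<in> cbox t m p" "w \<in> F v"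
              using small_box_L[OF t_Out] by blast
            then have "f v w \<le> f v t + p" "f v s - m \<le> f v w"
              using v unfolding cbox_def F_def by auto
            then show ?thesis by linarith
          qed
        qed
        then show ?thesis
          unfolding inv_def using KM ins K_le t_le K_eq M WFt
          by (intro exI[of _ "insert t K"] exI[of _ M]) auto
      next
        assume del: "W' = W - {t}"
        have "t \<notin> M" using t_Out KM(3) by blast
        then have "W' = (K - {t}) \<union> M" using del KM(1) by blast
        moreover have "reach n (L - F v) {} (W' \<inter> (L - F v))" if "v \<in> B" for v
          using WF'[OF that] K_eq'[OF that] del KM(1) by blast
        moreover have "K - {t} \<subseteq> C" using KM(2) by blast
        moreover have "\<exists>z\<in>K - {t}. f v z = c v" if "v \<in> B" for v
          using K_eq'[OF that] by blast
        ultimately show ?thesis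
          using inv_I[of W' "K - {t}" M] KM(3) K_le M by blast
      qed
    next
      assume XM: "\<forall>x\<in>X. t + x \<in> M \<or> t + x \<notin> L"
      have t_C: "t \<notin> C"
      proof
        assume tC: "t \<in> C"
        obtain x where x: "x \<in> X" using X_nonempty by blast
        then have "t + x \<in> Out" using XM KM(3) compl_L by blast
        then obtain v where "v \<in> B" "2 * R < \<bar>f v (t + x) - f v t\<bar>"
          using sep tC by blast
        then show False using range_bound[OF X(1) x, of v] R_nonneg by (simp add: f_add)
      qed
      then have tK: "t \<notin> K" using KM(2) by blast
      obtain M' where M': "W' = K \<union> M'" "M' = insert t M \<or> M' = M - {t}"
        using t(2) KM(1) tK by (metis Un_Diff Diff_insert0 Diff_empty Un_insert_right)
      have disj: "K \<inter> M' = {}"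
      proof -
        have "K \<inter> M = {}" using sep KM(2,3) R_nonneg by force
        then show ?thesis using M'(2) tK by blast
      qed
      have finK: "finite K" "finite M'" "finite M" using fin KM(1) M'(1) by auto
      \<comment> \<open>The cluster always holds at least one of the \<open>n + 1\<close> zeros. The
        rest therefore evolves with at most \<open>n\<close>, and \<open>IH\<close> keeps it in
        \<open>Out\<close>.\<close>
      have "K \<noteq> {}" using K_eq B_nonempty by blast
      then have "0 < card K" using finK by (simp add: card_gt_0_iff)
      then have "card M' \<le> n"
        using fin M'(1) disj finK by (simp add: card_Un_disjoint)
      then have "move n L M M'"
        unfolding move_def using M' finK XM X(1) t(1) reach_finite[OF M] by blast
      then have M'_reach: "reach n L {} M'" using M by simp
      have "M' \<subseteq> Out" using IH[OF M'_reach] small_box_L by blast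
      moreover have "reach n (L - F v) {} (W' \<inter> (L - F v))" if "v \<in> B" for v
        using WF'[OF that] K_eq[OF that] M'(1) by blast
      ultimately show ?thesis
        using inv_I[OF M'(1) KM(2) _ K_le K_eq M'_reach] by blast
    qed
  qed
  then show ?thesis unfolding inv_def using B_nonempty by blast
qed

section \<open>Induction on the number of zeros\<close>

lemma cbox_not_subset_domain:
  assumes "reach n L {} Z" "s \<in> Z"
  shows "\<not> cbox s (R * real n * 2 ^ n) (2 * R * (2 ^ n - 1)) \<subseteq> L"
  using assms
proof (induction n arbitrary: L Z s)
  case 0
  then show ?case using reach_finite by fastforce
next
  case (Suc n)
  define m p m' p' where defs: "m = R * real n * 2 ^ n" "p = 2 * R * (2 ^ n - 1)"
    "m' = R * real (Suc n) * 2 ^ Suc n" "p' = 2 * R * (2 ^ Suc n - 1)"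
  have mp: "0 \<le> m" "0 \<le> p" unfolding defs using R_nonneg by simp_all
  \<comment> \<open>The closed forms solve both recursions with equality, starting from 0 at
    \<open>n = 0\<close>.\<close>
  have rec: "2 * p + 2 * R \<le> p'" "2 * m + p + 2 * R \<le> m'"
    unfolding defs by (simp_all add: algebra_simps)
  show ?case unfolding defs[symmetric]
  proof
    assume sub: "cbox s m' p' \<subseteq> L"
    let ?L = "cbox s m' p'"
    have "s \<in> ?L" "s \<in> cbox s m p"
      using mp rec R_nonneg unfolding cbox_def by auto
    have AL: "cbox s m p \<subseteq> ?L"
    proof
      fix z assume "z \<in> cbox s m p"
      then show "z \<in> ?L" using mp rec R_nonneg unfolding cbox_def by fastforce
    qed
    have "\<not> Suc n < card (Y \<inter> ?L)" if "reach (Suc n) L {} Y" for Y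
      using reach_finite[OF that] card_mono[of Y "Y \<inter> ?L"] by auto
    then have "reach (Suc n) ?L {} (Z \<inter> ?L)"
      using reach_restrict_or_full[OF Suc.prems(1) sub] by blast
    then have "(\<exists>Y. reach (Suc n) ?L {} Y \<and> n < card (Y \<inter> cbox s m p)) \<or>
        reach n (cbox s m p) {} (Z \<inter> ?L \<inter> cbox s m p)"
      using AL by (rule reach_restrict_or_full)
    \<comment> \<open>Here the domain is the small box itself, so \<open>IH\<close> forbids reaching
      \<open>s\<close>.\<close>
    moreover have "\<not> reach n (cbox s m p) {} (Z \<inter> ?L \<inter> cbox s m p)"
      using Suc.IH[of "cbox s m p" "Z \<inter> ?L \<inter> cbox s m p" s] Suc.prems(2)
        \<open>s \<in> ?L\<close> \<open>s \<in> cbox s m p\<close> unfolding defs by blast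
    ultimately obtain Y where Y: "reach (Suc n) ?L {} Y" "n < card (Y \<inter> cbox s m p)"
      by blast
    have "Y \<inter> cbox s m p = Y"
      using reach_finite[OF Y(1)] Y(2) by (intro card_seteq) auto
    then have "Y \<subseteq> cbox s m p" by blast
    moreover have "finite Y" "Y \<noteq> {}" using reach_finite[OF Y(1)] Y(2) by auto
    \<comment> \<open>The reversed path leads from \<open>Y\<close> to the empty set, which a
      persistent cluster excludes.\<close>
    ultimately show False
      using isolated_cluster_persists[of n m p p' m' Y s "{}"] Suc.IH mp rec
        reach_sym[OF Y(1)] unfolding defs(1,2) by blast
  qed
qed

end

section \<open>Coordinates given by stable directions\<close>

text \<open>A proper span would lie in a hyperplane, which would then contain all stable
  directions.\<close>

lemma span_stable_directions:
  assumes "\<not> supercritical_unrooted (U :: (int ^ 'd) set set)"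
  shows "span {u. stable_direction U u} = UNIV"
proof (rule ccontr)
  assume "span {u. stable_direction U u} \<noteq> UNIV"
  then obtain a where a: "a \<noteq> 0" "span {u. stable_direction U u} \<subseteq> {x. a \<bullet> x = 0}"
    using span_not_univ_subset_hyperplane by blast
  have "dim {x. a \<bullet> x = 0} = CARD('d) - 1"
    using dim_hyperplane[OF a(1)] by simp
  moreover have "{u. stable_direction U u} \<subseteq> {x. a \<bullet> x = 0}"
    using a(2) span_superset by blast
  ultimately show False
    using assms subspace_hyperplane unfolding supercritical_unrooted_def by blast
qed

lemma inner_rvec_add: "inner (rvec (x + y)) v = inner (rvec x) v + inner (rvec y) v"
  by (simp add: rvec_def inner_vec_def sum.distrib algebra_simps)

text \<open>Expanding the axis vectors in \<open>B\<close> turns bounds on the \<open>f v\<close>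
  into bounds on the lattice coordinates, as needed to fit a \<open>cbox\<close> into a cube.
  \<open>Q\<close> sums the absolute values of all coefficients.\<close>

lemma coordinates_bounded_by_spanning_set:
  fixes B :: "(real ^ 'd) set"
  assumes "finite B" "span B = UNIV"
  obtains Q where "0 \<le> Q"
    "\<And>x t i. (\<And>v. v \<in> B \<Longrightarrow> \<bar>inner (rvec x) v\<bar> \<le> t) \<Longrightarrow> \<bar>real_of_int (x $ i)\<bar> \<le> Q * t"
proof -
  have "\<exists>q. axis i 1 = (\<Sum>v\<in>B. q v *\<^sub>R v)" for i :: 'd
  proof -
    have "axis i 1 \<in> span B" using assms(2) by simp
    then show ?thesis unfolding span_finite[OF assms(1)] by auto
  qed
  then obtain q where q: "\<And>i::'d. axis i 1 = (\<Sum>v\<in>B. q i v *\<^sub>R v)" by metis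
  define Q where "Q = (\<Sum>i\<in>UNIV. \<Sum>v\<in>B. \<bar>q i v\<bar>)"
  have "\<bar>real_of_int (x $ i)\<bar> \<le> Q * t"
    if t: "\<And>v. v \<in> B \<Longrightarrow> \<bar>inner (rvec x) v\<bar> \<le> t" for x t i
  proof -
    have "B \<noteq> {}" using q[of i] by (auto simp: axis_eq_0_iff)
    then have "0 \<le> t" using t by force
    have "real_of_int (x $ i) = inner (rvec x) (axis i 1)"
      by (simp add: inner_axis rvec_def)
    also have "\<dots> = (\<Sum>v\<in>B. q i v * inner (rvec x) v)"
      unfolding q by (simp add: inner_sum_right)
    also have "\<bar>\<dots>\<bar> \<le> (\<Sum>v\<in>B. \<bar>q i v\<bar> * t)"
      by (intro order.trans[OF sum_abs] sum_mono) (auto simp: abs_mult intro!: mult_left_mono t)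
    also have "\<dots> = (\<Sum>v\<in>B. \<bar>q i v\<bar>) * t" by (simp add: sum_distrib_right)
    also have "\<dots> \<le> Q * t"
      unfolding Q_def by (intro mult_right_mono \<open>0 \<le> t\<close> member_le_sum) (auto intro: sum_nonneg)
    finally show ?thesis .
  qed
  moreover have "0 \<le> Q" unfolding Q_def by (intro sum_nonneg) auto
  ultimately show ?thesis using that by blast
qed

section \<open>Transfer to legal paths in the cube\<close>

lemma config_eq_1_iff: "\<eta> \<in> config \<Lambda> \<Longrightarrow> x \<in> \<Lambda> \<Longrightarrow> \<eta> x = 1 \<longleftrightarrow> \<eta> x \<noteq> 0"
  by (auto simp: config_def)

theorem theorem2p4:
  fixes U :: "(int ^ 'd) set set"
  assumes "update_family U"
    and "\<not> supercritical_unrooted U"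
  shows "\<exists>\<kappa>::real. \<kappa> > 0 \<and>
           (\<forall>n::nat. \<forall>\<eta> \<in> V U n (box \<lfloor>\<kappa> * real n * 2 ^ n\<rfloor> :: (int ^ 'd) set).
              \<eta> 0 = 1)"
proof -
  obtain B where B: "B \<subseteq> {u. stable_direction U u}" "finite B" "span B = UNIV"
    using basis_exists[of "{u. stable_direction U u}"] span_stable_directions[OF assms(2)]
    by (metis finiteI_independent span_mono span_span span_eq top.extremum_uniqueI)
  define f where "f v x = inner (rvec x) v" for v and x :: "int ^ 'd"
  define R where "R = (\<Sum>v\<in>B. \<Sum>x\<in>\<Union>U. \<bar>f v x\<bar>)"
  have fin: "finite (\<Union>U)" using assms(1) unfolding update_family_def by blast
  have "B \<noteq> {}"
  proof
    assume "B = {}"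
    then have "axis i 1 \<in> ({0} :: (real ^ 'd) set)" for i :: 'd using B(3) by simp
    then show False by (simp add: axis_eq_0_iff)
  qed
  interpret stable_coords U B f R
  proof
    show "f v (x + y) = f v x + f v y" for v x y
      unfolding f_def by (rule inner_rvec_add)
    show "0 \<notin> X" if "X \<in> U" for X
      using assms(1) that unfolding update_family_def by blast
    show "\<exists>x\<in>X. 0 \<le> f v x" if "X \<in> U" "v \<in> B" for X v
      using that B(1) unfolding stable_direction_def halfspace_def f_def by fastforce
    show "\<bar>f v x\<bar> \<le> R" if "X \<in> U" "x \<in> X" "v \<in> B" for X x v
    proof -
      have "\<bar>f v x\<bar> \<le> (\<Sum>x\<in>\<Union>U. \<bar>f v x\<bar>)"
        using that fin by (intro member_le_sum) auto
      also have "\<dots> \<le> R"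
        unfolding R_def using that B(2)
        by (intro member_le_sum[where f = "\<lambda>v. \<Sum>x\<in>\<Union>U. \<bar>f v x\<bar>"]) (auto intro: sum_nonneg)
      finally show ?thesis .
    qed
    show "0 \<le> R" unfolding R_def by (intro sum_nonneg) auto
    show "B \<noteq> {}" by fact
  qed
  obtain Q where Q: "0 \<le> Q"
    "\<And>x t i. (\<And>v. v \<in> B \<Longrightarrow> \<bar>f v x\<bar> \<le> t) \<Longrightarrow> \<bar>real_of_int (x $ i)\<bar> \<le> Q * t"
    using coordinates_bounded_by_spanning_set[OF B(2,3)] unfolding f_def by metis
  \<comment> \<open>Both extents of the box are at most \<open>2 * R * n * 2 ^ n\<close>, and
    \<open>Q\<close> converts this to lattice coordinates. Adding 1 keeps the constant positive even
    if \<open>Q * R = 0\<close>.\<close>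
  have "\<eta> 0 = 1" if \<eta>: "\<eta> \<in> V U n (box \<lfloor>(2 * Q * R + 1) * real n * 2 ^ n\<rfloor>)" for n \<eta>
  proof (rule ccontr)
    let ?L = "box \<lfloor>(2 * Q * R + 1) * real n * 2 ^ n\<rfloor> :: (int ^ 'd) set"
    let ?m = "R * real n * 2 ^ n" and ?p = "2 * R * (2 ^ n - 1)"
    let ?Z = "\<lambda>\<xi>. {x \<in> ?L. \<xi> x = 0}"
    assume "\<eta> 0 \<noteq> 1"
    have sub: "cbox 0 ?m ?p \<subseteq> ?L"
    proof
      fix x assume x: "x \<in> cbox 0 ?m ?p"
      have f0: "f v 0 = 0" for v using f_add[of v 0 0] by simp
      have p_le: "?p \<le> 2 * R * real n * 2 ^ n"
      proof (cases n)
        case (Suc k)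
        then have "2 ^ n - 1 \<le> real n * 2 ^ n" by (simp add: algebra_simps)
        then show ?thesis using R_nonneg by (simp add: mult.assoc mult_left_mono)
      qed simp
      have "\<bar>f v x\<bar> \<le> 2 * R * real n * 2 ^ n" if "v \<in> B" for v
      proof -
        have "- ?m \<le> f v x" "f v x \<le> ?p" using x that unfolding cbox_def by (auto simp: f0)
        moreover have "?m \<le> 2 * R * real n * 2 ^ n" using R_nonneg by simp
        ultimately show ?thesis using p_le by linarith
      qed
      then have "\<bar>real_of_int (x $ i)\<bar> \<le> Q * (2 * R * real n * 2 ^ n)" for i
        using Q(2) by blast
      also have "\<dots> \<le> (2 * Q * R + 1) * real n * 2 ^ n" by (simp add: algebra_simps)
      finally have "\<bar>real_of_int (x $ i)\<bar> \<le> (2 * Q * R + 1) * real n * 2 ^ n" for i .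
      then have "real_of_int (\<bar>x $ i\<bar>) \<le> (2 * Q * R + 1) * real n * 2 ^ n" for i by simp
      then have "\<bar>x $ i\<bar> \<le> \<lfloor>(2 * Q * R + 1) * real n * 2 ^ n\<rfloor>" for i
        unfolding le_floor_iff .
      then show "x \<in> ?L" unfolding box_def by (simp add: abs_le_iff minus_le_iff)
    qed
    obtain q where q: "n_legal_path U n ?L q (ones ?L) \<eta>" and \<eta>c: "\<eta> \<in> config ?L"
      using \<eta> unfolding V_def by blast
    \<comment> \<open>Each legal move becomes a \<open>move\<close> of zero sets; moves that change
      nothing are absorbed by reflexivity.\<close>
    have reach: "reach n ?L {} (?Z (q ! j))" if "j < length q" for j
      using that
    proof (induction j)
      case 0
      then have "?Z (q ! 0) = {}"
        using q unfolding n_legal_path_def ones_def by (auto simp: hd_conv_nth)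
      then show ?case by (simp only: rtranclp.rtrancl_refl)
    next
      case (Suc j)
      have IH: "reach n ?L {} (?Z (q ! j))" using Suc by simp
      have mv: "legal_move U ?L (q ! j) (q ! Suc j)" and cf: "q ! j \<in> config ?L"
        and card: "card (?Z (q ! j)) \<le> n" "card (?Z (q ! Suc j)) \<le> n"
        using q Suc.prems unfolding n_legal_path_def num_zeros_def by auto
      show ?case
      proof (cases "q ! Suc j = q ! j")
        case False
        then obtain s X where s: "s \<in> ?L" "q ! Suc j = flip (q ! j) s"
          and X: "X \<in> U" "\<forall>y\<in>X. (q ! j) (s + y) = 0"
          using mv unfolding legal_move_def by blast
        have tog: "?Z (q ! Suc j) = insert s (?Z (q ! j)) \<or> ?Z (q ! Suc j) = ?Z (q ! j) - {s}"
        proof (cases "(q ! j) s = 0")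
          case True
          then have "?Z (q ! Suc j) = ?Z (q ! j) - {s}"
            unfolding s(2) flip_def by (auto split: if_splits)
          then show ?thesis ..
        next
          case False
          then have "(q ! j) s = 1" using config_eq_1_iff[OF cf s(1)] by blast
          then have "?Z (q ! Suc j) = insert s (?Z (q ! j))"
            unfolding s(2) flip_def using s(1) by (auto split: if_splits)
          then show ?thesis ..
        qed
        have leg: "\<exists>X\<in>U. \<forall>x\<in>X. s + x \<in> ?Z (q ! j) \<or> s + x \<notin> ?L" using X by blast
        have fin: "finite (?Z (q ! j))" using reach_finite[OF IH] by blast
        from tog have "finite (?Z (q ! Suc j))"
        proof
          assume eq: "?Z (q ! Suc j) = insert s (?Z (q ! j))"
          show ?thesis unfolding eq using fin by (rule finite.insertI)
        next
          assume eq: "?Z (q ! Suc j) = ?Z (q ! j) - {s}"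
          show ?thesis unfolding eq using fin by (rule finite_Diff)
        qed
        then have "move n ?L (?Z (q ! j)) (?Z (q ! Suc j))"
          unfolding move_def by (intro conjI fin card bexI[OF _ s(1)] tog leg)
        then show ?thesis by (rule rtranclp.rtrancl_into_rtrancl[OF IH])
      qed (use IH in simp)
    qed
    have "length q \<ge> 2" "last q = \<eta>" using q unfolding n_legal_path_def by auto
    then have "q ! (length q - 1) = \<eta>" by (subst (asm) last_conv_nth) auto
    then have "reach n ?L {} (?Z \<eta>)" using reach[of "length q - 1"] \<open>length q \<ge> 2\<close> by simp
    moreover have "0 \<in> ?Z \<eta>"
    proof -
      have "0 \<in> cbox 0 ?m ?p" using R_nonneg unfolding cbox_def by simp
      then show ?thesis using sub \<open>\<eta> 0 \<noteq> 1\<close> config_eq_1_iff[OF \<eta>c, of 0] by blast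
    qed
    ultimately show False using cbox_not_subset_domain sub by blast
  qed
  moreover have "2 * Q * R + 1 > 0" using Q(1) R_nonneg by (simp add: add_nonneg_pos)
  ultimately show ?thesis by blast
qed

end
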